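(* Let $f(z_1,z_2)=1-z_1z_2$. Then $f$ is cyclic in $\mathfrak{D}_\alpha$ if and only if $\alpha\le 1/2$.
   Context: For $\alpha\in\mathbb{R}$, $\mathfrak{D}_\alpha$ is the Hilbert space of holomorphic functions $f(z_1,z_2)=\sum_{k,l\ge0}a_{k,l}z_1^kz_2^l$ on the bidisk $\mathbb{D}^2$ with $\|f\|_\alpha^2=\sum_{k,l\ge0}(k+1)^\alpha(l+1)^\alpha|a_{k,l}|^2<\infty$. A function $f\in\mathfrak{D}_\alpha$ is cyclic if the closed linear span of $\{z_1^kz_2^lf: k,l\ge0\}$ is all of $\mathfrak{D}_\alpha$; equivalently, there are polynomials $p_n$ in two variables with $\|p_nf-1\|_\alpha\to0$. *)

theory Defs
  imports "HOL-Analysis.Analysis" "HOL-Library.Function_Algebras"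
begin

definition bidisk :: "(complex \<times> complex) set" where
  "bidisk = ball 0 1 \<times> ball 0 1"

text \<open>
  A function on the bidisk is holomorphic iff it is the sum of an (unconditionally) convergent
  power series there. The ambient type is the full function type, but values outside the bidisk
  are irrelevant: all notions below depend only on the restriction to the bidisk.
  The coefficients of such a series are unique, which justifies the definite description below.
\<close>

definition has_power_series :: "(complex \<times> complex \<Rightarrow> complex) \<Rightarrow> (nat \<times> nat \<Rightarrow> complex) \<Rightarrow> bool" where
  "has_power_series f a \<longleftrightarrow>
     (\<forall>(z1, z2) \<in> bidisk. ((\<lambda>(k, l). a (k, l) * z1 ^ k * z2 ^ l) has_sum f (z1, z2)) UNIV)"

definition power_coeff :: "(complex \<times> complex \<Rightarrow> complex) \<Rightarrow> nat \<times> nat \<Rightarrow> complex" where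
  "power_coeff f = (THE a. has_power_series f a)"

definition weighted_sq :: "real \<Rightarrow> (complex \<times> complex \<Rightarrow> complex) \<Rightarrow> nat \<times> nat \<Rightarrow> real" where
  "weighted_sq \<alpha> f = (\<lambda>(k, l).
     (real k + 1) powr \<alpha> * (real l + 1) powr \<alpha> * (cmod (power_coeff f (k, l)))\<^sup>2)"

definition dirichlet_space :: "real \<Rightarrow> (complex \<times> complex \<Rightarrow> complex) set" where
  "dirichlet_space \<alpha> = {f. (\<exists>a. has_power_series f a) \<and> weighted_sq \<alpha> f summable_on UNIV}"

definition dirichlet_norm :: "real \<Rightarrow> (complex \<times> complex \<Rightarrow> complex) \<Rightarrow> real" where
  "dirichlet_norm \<alpha> f = sqrt (infsum (weighted_sq \<alpha> f) UNIV)"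

interpretation cfun: vector_space "\<lambda>(c::complex) (f :: complex \<times> complex \<Rightarrow> complex) z. c * f z"
  by unfold_locales (auto simp: fun_eq_iff algebra_simps)

text \<open>
  Closure in the norm; intersecting with the space keeps the norm meaningful. (No restriction for
  the span used below, since multiplication by a monomial preserves the space.)
\<close>

definition dirichlet_closure ::
    "real \<Rightarrow> (complex \<times> complex \<Rightarrow> complex) set \<Rightarrow> (complex \<times> complex \<Rightarrow> complex) set" where
  "dirichlet_closure \<alpha> S = {g \<in> dirichlet_space \<alpha>.
     \<forall>\<epsilon>>0. \<exists>h \<in> S \<inter> dirichlet_space \<alpha>. dirichlet_norm \<alpha> (g - h) < \<epsilon>}"

definition cyclic :: "real \<Rightarrow> (complex \<times> complex \<Rightarrow> complex) \<Rightarrow> bool" where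
  "cyclic \<alpha> f \<longleftrightarrow> f \<in> dirichlet_space \<alpha> \<and>
     dirichlet_closure \<alpha> (cfun.span {(\<lambda>(z1, z2). z1 ^ k * z2 ^ l * f (z1, z2)) | k l. True})
       = dirichlet_space \<alpha>"

end

theory Submission
  imports Defs
begin

text \<open>
  If \<open>\<alpha> > 1/2\<close>, then by Cauchy-Schwarz the diagonal sum \<open>g \<mapsto> \<Sum>\<^sub>n a\<^sub>n\<^sub>,\<^sub>n\<close> is a bounded functional,
  because \<open>\<Sum> (n+1) powr (-2\<alpha>)\<close> converges. It annihilates every multiple \<open>z\<^sub>1\<^sup>k z\<^sub>2\<^sup>l f\<close> and maps \<open>1\<close> to \<open>1\<close>,
  so \<open>1\<close> is not in the closed span. If \<open>\<alpha> \<le> 1/2\<close>, each monomial differs by an element of the span from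
  weighted averages of its translates along the diagonal, and the norms of these averages can be made
  arbitrarily small because the inverse weights along a diagonal dominate a harmonic series. Hence
  the closed span contains all polynomials, and these are dense.
\<close>

section \<open>Power series coefficients\<close>

text \<open>Once the coefficients below \<open>m\<close> vanish, dividing by \<open>z ^ m\<close>
  leaves a series that sums to 0 on the punctured disk. Its limit at 0 is
  \<open>c m\<close>.\<close>

lemma powser_sums_zero_imp_coeff_zero:
  fixes c :: "nat \<Rightarrow> complex"
  assumes "\<And>z. norm z < 1 \<Longrightarrow> (\<lambda>n. c n * z ^ n) sums 0"
  shows "c m = 0"
proof (induction m rule: less_induct)
  case (less m)
  have "(\<lambda>n. c (n + m) * z ^ n) sums 0" if z: "z \<noteq> 0" "norm z < 1" for z
  proof -
    have "(\<lambda>n. c (n + m) * z ^ (n + m)) sums (0 - (\<Sum>i<m. c i * z ^ i))"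
      using sums_split_initial_segment[OF assms[OF z(2)]] by blast
    hence "(\<lambda>n. c (n + m) * z ^ (n + m)) sums 0" using less by simp
    from sums_divide[OF this, of "z ^ m"] show ?thesis using z by (simp add: power_add)
  qed
  from powser_limit_0_strong[of 1 "\<lambda>n. c (n + m)" "\<lambda>_. 0", OF _ this]
  have "((\<lambda>_. 0) \<longlongrightarrow> c m) (at (0::complex))" by simp
  thus ?case by (simp add: tendsto_const_iff)
qed

lemma has_power_series_add:
  assumes "has_power_series f a" "has_power_series g b"
  shows "has_power_series (\<lambda>z. f z + g z) (\<lambda>x. a x + b x)"
  unfolding has_power_series_def
proof safe
  fix z1 z2 assume "(z1, z2) \<in> bidisk"
  with assms have "((\<lambda>x. (case x of (k, l) \<Rightarrow> a (k, l) * z1 ^ k * z2 ^ l) +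
      (case x of (k, l) \<Rightarrow> b (k, l) * z1 ^ k * z2 ^ l)) has_sum (f (z1, z2) + g (z1, z2))) UNIV"
    by (intro has_sum_add) (auto simp: has_power_series_def)
  thus "((\<lambda>(k, l). (a (k, l) + b (k, l)) * z1 ^ k * z2 ^ l) has_sum (f (z1, z2) + g (z1, z2))) UNIV"
    by (simp add: case_prod_unfold algebra_simps)
qed

lemma has_power_series_scale:
  assumes "has_power_series f a"
  shows "has_power_series (\<lambda>z. c * f z) (\<lambda>x. c * a x)"
  unfolding has_power_series_def
proof safe
  fix z1 z2 assume "(z1, z2) \<in> bidisk"
  with assms have "((\<lambda>x. c * (case x of (k, l) \<Rightarrow> a (k, l) * z1 ^ k * z2 ^ l)) has_sum (c * f (z1, z2))) UNIV"
    by (intro has_sum_cmult_right) (auto simp: has_power_series_def)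
  thus "((\<lambda>(k, l). c * a (k, l) * z1 ^ k * z2 ^ l) has_sum (c * f (z1, z2))) UNIV"
    by (simp add: case_prod_unfold algebra_simps)
qed

lemma has_power_series_diff:
  assumes "has_power_series f a" "has_power_series g b"
  shows "has_power_series (f - g) (\<lambda>x. a x - b x)"
  using has_power_series_add[OF assms(1) has_power_series_scale[OF assms(2), of "-1"]]
  by (simp add: fun_diff_def)

lemma has_power_series_zero: "has_power_series (\<lambda>_. 0) (\<lambda>_. 0)"
  by (auto simp: has_power_series_def case_prod_unfold)

text \<open>The one-variable identity principle is applied twice: to the series in
  \<open>z1\<close>, whose coefficients are the row sums in \<open>z2\<close>, and then to each
  row.\<close>

lemma has_power_series_zero_imp_coeff_zero:
  assumes "has_power_series (\<lambda>_. 0) c"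
  shows "c (k, l) = 0"
proof -
  have zero: "((\<lambda>(k, l). c (k, l) * z1 ^ k * z2 ^ l) has_sum 0) (UNIV \<times> UNIV)"
    if "norm z1 < 1" "norm z2 < 1" for z1 z2
    using assms that by (auto simp: has_power_series_def bidisk_def)
  have slice: "(\<lambda>l. c (k, l) * z2 ^ l) summable_on UNIV" if z2: "norm z2 < 1" for k z2
  proof -
    \<comment> \<open>The point 1/2 is just a nonzero point of the disk: on a fixed row its power is
      a constant factor that can be cancelled.\<close>
    have "(\<lambda>(k, l). c (k, l) * (1/2) ^ k * z2 ^ l) summable_on (UNIV \<times> UNIV)"
      using zero[of "1/2" z2] z2 by (auto simp: summable_on_def)
    from summable_on_SigmaD1[OF this, of k]
    have "(\<lambda>l. c (k, l) * (1/2) ^ k * z2 ^ l) summable_on UNIV" by simp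
    from summable_on_cmult_right[OF this, of "2 ^ k"] show ?thesis
      by (simp add: field_simps)
  qed
  have inner: "(\<Sum>\<^sub>\<infinity>l. c (k, l) * z2 ^ l) = 0" if z2: "norm z2 < 1" for k z2
  proof (rule powser_sums_zero_imp_coeff_zero[where c = "\<lambda>k. \<Sum>\<^sub>\<infinity>l. c (k, l) * z2 ^ l"])
    fix z1 :: complex assume z1: "norm z1 < 1"
    have "((\<lambda>k. (\<Sum>\<^sub>\<infinity>l. c (k, l) * z2 ^ l) * z1 ^ k) has_sum 0) UNIV"
    proof (rule has_sum_SigmaD[OF zero[OF z1 z2]])
      fix k
      from has_sum_cmult_left[OF has_sum_infsum[OF slice[OF z2]], of k "z1 ^ k"]
      show "((\<lambda>l. case (k, l) of (k, l) \<Rightarrow> c (k, l) * z1 ^ k * z2 ^ l) has_sum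
          (\<Sum>\<^sub>\<infinity>l. c (k, l) * z2 ^ l) * z1 ^ k) UNIV"
        by (simp add: mult_ac)
    qed
    thus "(\<lambda>k. (\<Sum>\<^sub>\<infinity>l. c (k, l) * z2 ^ l) * z1 ^ k) sums 0" by (rule has_sum_imp_sums)
  qed
  show ?thesis
  proof (rule powser_sums_zero_imp_coeff_zero[where c = "\<lambda>l. c (k, l)"])
    fix z2 :: complex assume z2: "norm z2 < 1"
    from has_sum_imp_sums[OF has_sum_infsum[OF slice[OF z2]], of k]
    show "(\<lambda>l. c (k, l) * z2 ^ l) sums 0" by (simp add: inner[OF z2])
  qed
qed

text \<open>Uniqueness makes the definite description usable: norms and membership can be computed
  from any coefficient array that represents the function.\<close>

lemma power_coeff_eq:
  assumes "has_power_series f a"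
  shows "power_coeff f = a"
  unfolding power_coeff_def
proof (rule the_equality, rule assms)
  fix b assume "has_power_series f b"
  from has_power_series_diff[OF this assms] have "has_power_series (\<lambda>_. 0) (\<lambda>x. b x - a x)"
    by (simp add: fun_diff_def zero_fun_def)
  from has_power_series_zero_imp_coeff_zero[OF this] show "b = a" by (auto simp: fun_eq_iff)
qed

definition coeff_unit :: "nat \<times> nat \<Rightarrow> nat \<times> nat \<Rightarrow> complex" where
  "coeff_unit p = (\<lambda>x. if x = p then 1 else 0)"

lemma has_power_series_monomial:
  "has_power_series (\<lambda>(z1, z2). z1 ^ k * z2 ^ l) (coeff_unit (k, l))"
  unfolding has_power_series_def
  by (auto intro!: has_sum_finite_neutralI[where B = "{(k, l)}"] simp: coeff_unit_def split: if_splits)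

section \<open>The weighted norm in terms of coefficients\<close>

definition weight :: "real \<Rightarrow> nat \<times> nat \<Rightarrow> real" where
  "weight \<alpha> = (\<lambda>(k, l). (real k + 1) powr \<alpha> * (real l + 1) powr \<alpha>)"

text \<open>Finiteness is tracked separately because \<open>infsum\<close> defaults to 0 on families
  that are not summable, so a small \<open>energy\<close> alone would say nothing.\<close>

definition finite_energy :: "real \<Rightarrow> (nat \<times> nat \<Rightarrow> complex) \<Rightarrow> bool" where
  "finite_energy \<alpha> a \<longleftrightarrow> (\<lambda>x. weight \<alpha> x * (cmod (a x))\<^sup>2) summable_on UNIV"

definition energy :: "real \<Rightarrow> (nat \<times> nat \<Rightarrow> complex) \<Rightarrow> real" where
  "energy \<alpha> a = (\<Sum>\<^sub>\<infinity>x. weight \<alpha> x * (cmod (a x))\<^sup>2)"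

lemma weight_pos: "weight \<alpha> x > 0"
  by (cases x) (simp add: weight_def)

lemma weighted_nonneg: "0 \<le> weight \<alpha> x * (cmod u)\<^sup>2"
  by (intro mult_nonneg_nonneg less_imp_le[OF weight_pos] zero_le_power2)

lemma weighted_sq_eq:
  assumes "has_power_series f a"
  shows "weighted_sq \<alpha> f = (\<lambda>x. weight \<alpha> x * (cmod (a x))\<^sup>2)"
  by (auto simp: weighted_sq_def weight_def power_coeff_eq[OF assms])

lemma dirichlet_space_iff:
  "f \<in> dirichlet_space \<alpha> \<longleftrightarrow> (\<exists>a. has_power_series f a \<and> finite_energy \<alpha> a)"
  unfolding dirichlet_space_def finite_energy_def using weighted_sq_eq by fastforce

lemma dirichlet_norm_eq:
  assumes "has_power_series f a"
  shows "dirichlet_norm \<alpha> f = sqrt (energy \<alpha> a)"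
  by (simp add: dirichlet_norm_def energy_def weighted_sq_eq[OF assms])

lemma energy_nonneg: "energy \<alpha> a \<ge> 0"
  unfolding energy_def by (intro infsum_nonneg weighted_nonneg)

text \<open>This crude substitute for the triangle inequality works with squared norms throughout;
  the factor 2 is harmless, since only smallness matters.\<close>

lemma weighted_add_le:
  "weight \<alpha> x * (cmod (u + v))\<^sup>2 \<le> 2 * (weight \<alpha> x * (cmod u)\<^sup>2) + 2 * (weight \<alpha> x * (cmod v)\<^sup>2)"
proof -
  have "(cmod (u + v))\<^sup>2 \<le> (cmod u + cmod v)\<^sup>2"
    by (intro power_mono norm_triangle_ineq) auto
  also have "\<dots> \<le> 2 * (cmod u)\<^sup>2 + 2 * (cmod v)\<^sup>2"
    using zero_le_power2[of "cmod u - cmod v"] by (simp add: power2_eq_square algebra_simps)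
  finally have "weight \<alpha> x * (cmod (u + v))\<^sup>2 \<le> weight \<alpha> x * (2 * (cmod u)\<^sup>2 + 2 * (cmod v)\<^sup>2)"
    by (intro mult_left_mono) (auto intro: less_imp_le weight_pos)
  thus ?thesis by (simp add: algebra_simps)
qed

lemma
  assumes "finite_energy \<alpha> a" "finite_energy \<alpha> b"
  shows finite_energy_add: "finite_energy \<alpha> (\<lambda>x. a x + b x)"
    and energy_add_le: "energy \<alpha> (\<lambda>x. a x + b x) \<le> 2 * energy \<alpha> a + 2 * energy \<alpha> b"
proof -
  let ?w = "\<lambda>a x. weight \<alpha> x * (cmod (a x))\<^sup>2"
  have s: "(\<lambda>x. 2 * ?w a x + 2 * ?w b x) summable_on UNIV"
    using assms unfolding finite_energy_def by (intro summable_on_add summable_on_cmult_right)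
  show fin: "finite_energy \<alpha> (\<lambda>x. a x + b x)"
    unfolding finite_energy_def
    by (rule summable_on_comparison_test[OF s weighted_add_le weighted_nonneg])
  have "energy \<alpha> (\<lambda>x. a x + b x) \<le> (\<Sum>\<^sub>\<infinity>x. 2 * ?w a x + 2 * ?w b x)"
    using fin s unfolding energy_def finite_energy_def by (intro infsum_mono weighted_add_le) auto
  also have "\<dots> = 2 * energy \<alpha> a + 2 * energy \<alpha> b"
    using assms unfolding energy_def finite_energy_def
    by (subst infsum_add) (auto intro: summable_on_cmult_right simp: infsum_cmult_right')
  finally show "energy \<alpha> (\<lambda>x. a x + b x) \<le> 2 * energy \<alpha> a + 2 * energy \<alpha> b" .
qed

lemma
  shows finite_energy_scale: "finite_energy \<alpha> a \<Longrightarrow> finite_energy \<alpha> (\<lambda>x. c * a x)"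
    and energy_scale: "energy \<alpha> (\<lambda>x. c * a x) = (cmod c)\<^sup>2 * energy \<alpha> a"
proof -
  have *: "(\<lambda>x. weight \<alpha> x * (cmod (c * a x))\<^sup>2) = (\<lambda>x. (cmod c)\<^sup>2 * (weight \<alpha> x * (cmod (a x))\<^sup>2))"
    by (auto simp: norm_mult power_mult_distrib)
  show "finite_energy \<alpha> (\<lambda>x. c * a x)" if "finite_energy \<alpha> a"
    using that unfolding finite_energy_def * by (rule summable_on_cmult_right)
  show "energy \<alpha> (\<lambda>x. c * a x) = (cmod c)\<^sup>2 * energy \<alpha> a"
    unfolding energy_def * by (rule infsum_cmult_right')
qed

lemma finite_energy_diff:
  "finite_energy \<alpha> a \<Longrightarrow> finite_energy \<alpha> b \<Longrightarrow> finite_energy \<alpha> (\<lambda>x. a x - b x)"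
  using finite_energy_add[of \<alpha> a "\<lambda>x. (-1) * b x"] finite_energy_scale[of \<alpha> b "-1"] by simp

lemma
  assumes "finite F" "\<And>x. x \<notin> F \<Longrightarrow> a x = 0"
  shows finite_energy_finite_support: "finite_energy \<alpha> a"
    and energy_finite_support: "energy \<alpha> a = (\<Sum>x\<in>F. weight \<alpha> x * (cmod (a x))\<^sup>2)"
proof -
  have "((\<lambda>x. weight \<alpha> x * (cmod (a x))\<^sup>2) has_sum (\<Sum>x\<in>F. weight \<alpha> x * (cmod (a x))\<^sup>2)) UNIV"
    using assms by (intro has_sum_finite_neutralI[where B = F]) auto
  thus "finite_energy \<alpha> a" "energy \<alpha> a = (\<Sum>x\<in>F. weight \<alpha> x * (cmod (a x))\<^sup>2)"
    unfolding finite_energy_def energy_def by (auto simp: summable_on_def infsumI)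
qed

lemma finite_energy_unit: "finite_energy \<alpha> (coeff_unit p)"
  by (rule finite_energy_finite_support[of "{p}"]) (auto simp: coeff_unit_def)

text \<open>Tails of a convergent sum are small. On the coefficient side this is the density of the
  polynomials.\<close>

lemma energy_truncation:
  assumes a: "finite_energy \<alpha> a" and "\<epsilon> > 0"
  obtains F where "finite F" "energy \<alpha> (\<lambda>x. if x \<in> F then 0 else a x) < \<epsilon>"
proof -
  let ?w = "\<lambda>x. weight \<alpha> x * (cmod (a x))\<^sup>2"
  \<comment> \<open>Half of \<epsilon> is used because the approximation is only non-strict, while
    the conclusion is strict.\<close>
  from infsum_finite_approximation[of ?w UNIV "\<epsilon> / 2"] assms
  obtain F where F: "finite F" "dist (sum ?w F) (infsum ?w UNIV) \<le> \<epsilon> / 2"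
    unfolding finite_energy_def by auto
  have "energy \<alpha> (\<lambda>x. if x \<in> F then 0 else a x) = infsum ?w (UNIV - F)"
    unfolding energy_def by (rule infsum_cong_neutral) auto
  also have "\<dots> = infsum ?w UNIV - infsum ?w F"
    using a F(1) unfolding finite_energy_def by (intro infsum_Diff) auto
  also have "\<dots> < \<epsilon>" 
  proof -
    have "infsum ?w UNIV - sum ?w F \<le> \<epsilon> / 2"
      using F(2) unfolding dist_real_def by linarith
    with \<open>\<epsilon> > 0\<close> F(1) show ?thesis by simp
  qed
  finally show ?thesis using that F(1) by blast
qed

section \<open>The invariant subspace generated by \<open>1 - z\<^sub>1 z\<^sub>2\<close>\<close>

text \<open>The inner \<open>case\<close> keeps the generators literally equal to those that
  \<open>cyclic\<close> produces for this function, so unfolding matches the two sets.\<close>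

definition generated_span :: "(complex \<times> complex \<Rightarrow> complex) set" where
  "generated_span = cfun.span {(\<lambda>(z1, z2). z1 ^ k * z2 ^ l * (case (z1, z2) of (z1, z2) \<Rightarrow> 1 - z1 * z2)) | k l. True}"

lemma generated_span_base: "(\<lambda>(z1, z2). z1 ^ k * z2 ^ l * (1 - z1 * z2)) \<in> generated_span"
  unfolding generated_span_def by (rule cfun.span_base) auto

lemma generated_span_zero: "(\<lambda>_. 0) \<in> generated_span"
  using cfun.span_zero unfolding generated_span_def by (simp add: zero_fun_def)

lemma generated_span_add:
  "f \<in> generated_span \<Longrightarrow> g \<in> generated_span \<Longrightarrow> (\<lambda>z. f z + g z) \<in> generated_span"
  using cfun.span_add unfolding generated_span_def by (fastforce simp: plus_fun_def)

lemma generated_span_scale: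
  "f \<in> generated_span \<Longrightarrow> (\<lambda>z. c * f z) \<in> generated_span"
  unfolding generated_span_def by (rule cfun.span_scale)

section \<open>The diagonal sum functional and telescoping along diagonals\<close>

text \<open>A generator is the difference of two monomials one step apart on the same diagonal, so
  its diagonal sum cancels; linearity extends this to the span.\<close>

lemma generated_span_diagonal_sum:
  assumes "h \<in> generated_span"
  shows "\<exists>a. has_power_series h a \<and> ((\<lambda>n. a (n, n)) has_sum 0) UNIV"
  using assms unfolding generated_span_def
proof (induction rule: cfun.span_induct_alt)
  case base
  show ?case using has_power_series_zero by (intro exI[of _ "\<lambda>_. 0"]) (auto simp: zero_fun_def)
next
  case (step c f g)
  then obtain k l b where f: "f = (\<lambda>(z1, z2). z1 ^ k * z2 ^ l * (1 - z1 * z2))"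
    and b: "has_power_series g b" "((\<lambda>n. b (n, n)) has_sum 0) UNIV" by auto
  let ?a = "\<lambda>x. coeff_unit (k, l) x - coeff_unit (Suc k, Suc l) x"
  have "has_power_series f ?a"
    using has_power_series_diff[OF has_power_series_monomial[of k l] has_power_series_monomial[of "Suc k" "Suc l"]]
    by (simp add: f fun_diff_def case_prod_unfold algebra_simps)
  moreover have "((\<lambda>n. ?a (n, n)) has_sum 0) UNIV"
    \<comment> \<open>For \<open>k = l\<close> the entries 1 and -1 cancel; otherwise every diagonal
      entry is 0.\<close>
    by (rule has_sum_finite_neutralI[where B = "{k, Suc k}"]) (auto simp: coeff_unit_def)
  ultimately show ?case
    using has_power_series_add[OF has_power_series_scale b(1), of f ?a c]
      has_sum_add[OF has_sum_cmult_right b(2), of "\<lambda>n. ?a (n, n)" 0 c]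
    by (intro exI[of _ "\<lambda>x. c * ?a x + b x"]) (auto simp: plus_fun_def)
qed

text \<open>The diagonal weight is \<open>(n + 1) powr (2 * \<alpha>)\<close>. Splitting off its
  square root and applying Cauchy-Schwarz to partial sums leaves a series of inverse weights,
  convergent since \<open>2 * \<alpha> > 1\<close>; the bound then passes to the limit.\<close>

lemma diagonal_sum_bound:
  assumes "\<alpha> > 1 / 2" and b: "finite_energy \<alpha> b" and s: "((\<lambda>n. b (n, n)) has_sum s) UNIV"
  shows "(cmod s)\<^sup>2 \<le> (\<Sum>n. (real n + 1) powr (- 2 * \<alpha>)) * energy \<alpha> b"
proof -
  let ?u = "\<lambda>n. (real n + 1) powr (- 2 * \<alpha>)"
  have "summable (\<lambda>n. real n powr (- 2 * \<alpha>))" using assms(1) by (subst summable_real_powr_iff) auto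
  hence sum_u: "summable ?u"
    using summable_iff_shift[of "\<lambda>n. real n powr (- 2 * \<alpha>)" 1] by (simp add: add_ac)
  have bound: "(cmod (\<Sum>n<N. b (n, n)))\<^sup>2 \<le> suminf ?u * energy \<alpha> b" for N
  proof -
    have "cmod (\<Sum>n<N. b (n, n)) \<le> (\<Sum>n<N. (real n + 1) powr (-\<alpha>) * ((real n + 1) powr \<alpha> * cmod (b (n, n))))"
      by (rule order_trans[OF norm_sum], rule sum_mono) (simp add: mult.assoc[symmetric] powr_add[symmetric])
    hence "(cmod (\<Sum>n<N. b (n, n)))\<^sup>2 \<le> (\<Sum>n<N. (real n + 1) powr (-\<alpha>) * ((real n + 1) powr \<alpha> * cmod (b (n, n))))\<^sup>2"
      by (intro power_mono) auto
    also have "\<dots> \<le> (\<Sum>n<N. ((real n + 1) powr (-\<alpha>))\<^sup>2) * (\<Sum>n<N. ((real n + 1) powr \<alpha> * cmod (b (n, n)))\<^sup>2)"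
      by (rule Cauchy_Schwarz_ineq_sum)
    also have "(\<Sum>n<N. ((real n + 1) powr (-\<alpha>))\<^sup>2) = (\<Sum>n<N. ?u n)"
      by (simp add: power2_eq_square flip: powr_add)
    also have "(\<Sum>n<N. ((real n + 1) powr \<alpha> * cmod (b (n, n)))\<^sup>2) =
        (\<Sum>x\<in>(\<lambda>n. (n, n)) ` {..<N}. weight \<alpha> x * (cmod (b x))\<^sup>2)"
      by (subst sum.reindex) (auto simp: inj_on_def weight_def power2_eq_square mult_ac)
    also have "(\<Sum>n<N. ?u n) * \<dots> \<le> suminf ?u * energy \<alpha> b"
      using b unfolding energy_def finite_energy_def
      by (intro mult_mono sum_le_suminf[OF sum_u] finite_sum_le_infsum suminf_nonneg[OF sum_u] sum_nonneg)
         (auto intro: weighted_nonneg)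
    finally show ?thesis .
  qed
  have "(\<lambda>N. (cmod (\<Sum>n<N. b (n, n)))\<^sup>2) \<longlonglongrightarrow> (cmod s)\<^sup>2"
    using has_sum_imp_sums[OF s] unfolding sums_def by (intro tendsto_intros)
  thus ?thesis using bound by (intro LIMSEQ_le_const2) auto
qed

text \<open>Consecutive monomials on a diagonal differ by a generator, so the difference
  telescopes.\<close>

lemma monomial_difference_in_generated_span:
  "(\<lambda>(z1, z2). z1 ^ k * z2 ^ l - z1 ^ (k + j) * z2 ^ (l + j)) \<in> generated_span"
proof (induction j)
  case 0
  show ?case using generated_span_zero by (simp add: case_prod_unfold)
next
  case (Suc j)
  from generated_span_add[OF Suc generated_span_base[of "k + j" "l + j"]]
  show ?case by (simp add: case_prod_unfold algebra_simps)
qed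

section \<open>Approximation for \<open>\<alpha> \<le> 1/2\<close>\<close>

text \<open>This is membership in the closed span, read off coefficients; \<epsilon> bounds the
  squared distance.\<close>

definition approximable :: "real \<Rightarrow> (nat \<times> nat \<Rightarrow> complex) \<Rightarrow> bool" where
  "approximable \<alpha> a \<longleftrightarrow> (\<forall>\<epsilon>>0. \<exists>h\<in>generated_span. \<exists>c.
     has_power_series h c \<and> finite_energy \<alpha> (\<lambda>x. a x - c x) \<and> energy \<alpha> (\<lambda>x. a x - c x) < \<epsilon>)"

lemma approximableE:
  assumes "approximable \<alpha> a" "\<epsilon> > 0"
  obtains h c where "h \<in> generated_span" "has_power_series h c"
    "finite_energy \<alpha> (\<lambda>x. a x - c x)" "energy \<alpha> (\<lambda>x. a x - c x) < \<epsilon>"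
  using assms unfolding approximable_def by blast

lemma approximable_zero: "approximable \<alpha> (\<lambda>_. 0)"
  unfolding approximable_def
proof (intro allI impI)
  fix \<epsilon> :: real assume "\<epsilon> > 0"
  thus "\<exists>h\<in>generated_span. \<exists>c. has_power_series h c \<and> finite_energy \<alpha> (\<lambda>x. 0 - c x) \<and> energy \<alpha> (\<lambda>x. 0 - c x) < \<epsilon>"
    by (intro bexI[OF _ generated_span_zero] exI[of _ "\<lambda>_. 0"])
       (auto simp: has_power_series_zero finite_energy_def energy_def)
qed

lemma approximable_add:
  assumes "approximable \<alpha> a" "approximable \<alpha> b"
  shows "approximable \<alpha> (\<lambda>x. a x + b x)"
  unfolding approximable_def
proof (intro allI impI)
  fix \<epsilon> :: real assume e: "\<epsilon> > 0"
  \<comment> \<open>Both errors are doubled by \<open>energy_add_le\<close>, so a quarter of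
    \<epsilon> each is enough.\<close>
  hence e4: "\<epsilon> / 4 > 0" by simp
  obtain h c where h: "h \<in> generated_span" "has_power_series h c"
    "finite_energy \<alpha> (\<lambda>x. a x - c x)" "energy \<alpha> (\<lambda>x. a x - c x) < \<epsilon> / 4"
    using approximableE[OF assms(1) e4] .
  obtain g d where g: "g \<in> generated_span" "has_power_series g d"
    "finite_energy \<alpha> (\<lambda>x. b x - d x)" "energy \<alpha> (\<lambda>x. b x - d x) < \<epsilon> / 4"
    using approximableE[OF assms(2) e4] .
  have *: "(\<lambda>x. a x + b x - (c x + d x)) = (\<lambda>x. (a x - c x) + (b x - d x))" by auto
  show "\<exists>h\<in>generated_span. \<exists>c. has_power_series h c \<and> finite_energy \<alpha> (\<lambda>x. a x + b x - c x) \<and>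
      energy \<alpha> (\<lambda>x. a x + b x - c x) < \<epsilon>"
  proof (intro bexI[OF _ generated_span_add[OF h(1) g(1)]] exI conjI)
    show "has_power_series (\<lambda>z. h z + g z) (\<lambda>x. c x + d x)"
      by (rule has_power_series_add[OF h(2) g(2)])
    show "finite_energy \<alpha> (\<lambda>x. a x + b x - (c x + d x))"
      unfolding * by (rule finite_energy_add[OF h(3) g(3)])
    show "energy \<alpha> (\<lambda>x. a x + b x - (c x + d x)) < \<epsilon>"
      unfolding * using energy_add_le[OF h(3) g(3)] h(4) g(4) by linarith
  qed
qed

lemma approximable_scale:
  assumes "approximable \<alpha> a"
  shows "approximable \<alpha> (\<lambda>x. u * a x)"
proof (cases "u = 0")
  case True
  thus ?thesis by (simp add: approximable_zero)
next
  case False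
  show ?thesis
    unfolding approximable_def
  proof (intro allI impI)
    fix \<epsilon> :: real assume e: "\<epsilon> > 0"
    with False have e': "\<epsilon> / (cmod u)\<^sup>2 > 0" by simp
    obtain h c where h: "h \<in> generated_span" "has_power_series h c"
      "finite_energy \<alpha> (\<lambda>x. a x - c x)" "energy \<alpha> (\<lambda>x. a x - c x) < \<epsilon> / (cmod u)\<^sup>2"
      using approximableE[OF assms e'] .
    have *: "(\<lambda>x. u * a x - u * c x) = (\<lambda>x. u * (a x - c x))" by (auto simp: algebra_simps)
    show "\<exists>h\<in>generated_span. \<exists>c. has_power_series h c \<and> finite_energy \<alpha> (\<lambda>x. u * a x - c x) \<and>
        energy \<alpha> (\<lambda>x. u * a x - c x) < \<epsilon>"
    proof (intro bexI[OF _ generated_span_scale[OF h(1), of u]] exI conjI)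
      show "has_power_series (\<lambda>z. u * h z) (\<lambda>x. u * c x)"
        by (rule has_power_series_scale[OF h(2)])
      show "finite_energy \<alpha> (\<lambda>x. u * a x - u * c x)"
        unfolding * by (rule finite_energy_scale[OF h(3)])
      show "energy \<alpha> (\<lambda>x. u * a x - u * c x) < \<epsilon>"
        unfolding * energy_scale using h(4) False by (simp add: field_simps)
    qed
  qed
qed

section \<open>Growth of the weights along a diagonal\<close>

text \<open>Both bases are at least 1 and at most \<open>k + l + j + 1\<close>, so each factor is at
  most the square root of that number. The exponent 1/2 is exactly what makes the product linear in
  \<open>j\<close>.\<close>

lemma weight_diagonal_le:
  assumes "\<alpha> \<le> 1 / 2"
  shows "weight \<alpha> (k + j, l + j) \<le> real (k + l + j + 1)"
proof -
  have le: "(real m + 1) powr \<alpha> \<le> (real (k + l + j + 1)) powr (1/2)" if "m \<le> k + l + j" for m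
  proof -
    have "(real m + 1) powr \<alpha> \<le> (real m + 1) powr (1/2)" using assms by (intro powr_mono) auto
    also have "\<dots> \<le> (real (k + l + j + 1)) powr (1/2)" using that by (intro powr_mono2) auto
    finally show ?thesis .
  qed
  have "weight \<alpha> (k + j, l + j) \<le> (real (k + l + j + 1)) powr (1/2) * (real (k + l + j + 1)) powr (1/2)"
    unfolding weight_def prod.case by (intro mult_mono le) auto
  also have "\<dots> = real (k + l + j + 1)" by (subst powr_add[symmetric]) simp
  finally show ?thesis .
qed

text \<open>Bounded partial sums of positive terms would give convergence, and by the linear weight
  bound also convergence of a tail of the harmonic series.\<close>

lemma inverse_weight_sum_unbounded:
  assumes "\<alpha> \<le> 1 / 2"
  shows "\<exists>N. (\<Sum>j<N. inverse (weight \<alpha> (k + j, l + j))) > B"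
proof (rule ccontr)
  assume "\<not> ?thesis"
  hence "summable (\<lambda>j. inverse (weight \<alpha> (k + j, l + j)))"
    by (intro bounded_imp_summable[of _ B])
       (auto simp: lessThan_Suc_atMost[symmetric] not_less simp del: sum.lessThan_Suc intro: less_imp_le weight_pos)
  hence "summable (\<lambda>j. inverse (real (j + (k + l + 1))))"
  proof (rule summable_comparison_test'[where N = 0])
    fix j
    have "inverse (real (k + l + j + 1)) \<le> inverse (weight \<alpha> (k + j, l + j))"
      by (rule le_imp_inverse_le[OF weight_diagonal_le[OF assms] weight_pos])
    thus "norm (inverse (real (j + (k + l + 1)))) \<le> inverse (weight \<alpha> (k + j, l + j))"
      by (simp add: add_ac)
  qed
  thus False using summable_iff_shift[of "\<lambda>n. inverse (real n)"] not_summable_harmonic[where 'a = real] by blast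
qed

lemma has_power_series_sum:
  assumes "\<And>j. j \<in> A \<Longrightarrow> has_power_series (f j) (a j)"
  shows "has_power_series (\<lambda>z. \<Sum>j\<in>A. f j z) (\<lambda>x. \<Sum>j\<in>A. a j x)"
  using assms
  by (induction A rule: infinite_finite_induct) (auto intro: has_power_series_zero has_power_series_add)

lemma generated_span_sum:
  assumes "\<And>j. j \<in> A \<Longrightarrow> f j \<in> generated_span"
  shows "(\<lambda>z. \<Sum>j\<in>A. f j z) \<in> generated_span"
  using assms
  by (induction A rule: infinite_finite_induct) (auto intro: generated_span_zero generated_span_add)

lemma approximable_sum:
  assumes "\<And>j. j \<in> A \<Longrightarrow> approximable \<alpha> (a j)"
  shows "approximable \<alpha> (\<lambda>x. \<Sum>j\<in>A. a j x)"
  using assms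
  by (induction A rule: infinite_finite_induct) (auto intro: approximable_zero approximable_add)

text \<open>
  Modulo the span, a monomial equals every average \<open>\<Sum> r\<^sub>j z\<^sub>1\<^bsup>k+j\<^esup> z\<^sub>2\<^bsup>l+j\<^esup>\<close> with \<open>\<Sum> r\<^sub>j = 1\<close>.
  Taking \<open>r\<^sub>j\<close> proportional to the inverse weights \<open>1 / w\<^sub>j\<close> minimises the norm of the average;
  its square is then \<open>1 / \<Sum> (1 / w\<^sub>j)\<close>.
\<close>

lemma approximable_unit:
  assumes "\<alpha> \<le> 1 / 2"
  shows "approximable \<alpha> (coeff_unit (k, l))"
  unfolding approximable_def
proof (intro allI impI)
  fix \<epsilon> :: real assume e: "\<epsilon> > 0"
  define w where "w = (\<lambda>j. weight \<alpha> (k + j, l + j))"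
  have w: "w j > 0" for j unfolding w_def by (rule weight_pos)
  \<comment> \<open>The remainder will have energy exactly \<open>inverse T\<close>, so the sum
    \<open>T\<close> has to exceed \<open>inverse \<epsilon>\<close>.\<close>
  obtain N where N: "(\<Sum>j<N. inverse (w j)) > inverse \<epsilon>"
    using inverse_weight_sum_unbounded[OF assms] unfolding w_def by blast
  define T where "T = (\<Sum>j<N. inverse (w j))"
  define r where "r = (\<lambda>j. inverse (w j) / T)"
  have T: "T > 0" "inverse T < \<epsilon>"
    using less_trans[OF positive_imp_inverse_positive[OF e] N] e less_imp_inverse_less[OF N]
    unfolding T_def by auto
  have r_sum: "(\<Sum>j<N. r j) = 1"
    using T unfolding r_def by (simp add: T_def flip: sum_divide_distrib)
  define h where "h = (\<lambda>z::complex \<times> complex. \<Sum>j<N. complex_of_real (r j) *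
    (case z of (z1, z2) \<Rightarrow> z1 ^ k * z2 ^ l - z1 ^ (k + j) * z2 ^ (l + j)))"
  define c where "c = (\<lambda>x. \<Sum>j<N. complex_of_real (r j) * (coeff_unit (k, l) x - coeff_unit (k + j, l + j) x))"
  define d where "d = (\<lambda>x. coeff_unit (k, l) x - c x)"
  have h: "h \<in> generated_span"
    unfolding h_def by (intro generated_span_sum generated_span_scale monomial_difference_in_generated_span)
  have "has_power_series (\<lambda>(z1, z2). z1 ^ k * z2 ^ l - z1 ^ (k + j) * z2 ^ (l + j))
      (\<lambda>x. coeff_unit (k, l) x - coeff_unit (k + j, l + j) x)" for j
    using has_power_series_diff[OF has_power_series_monomial[of k l] has_power_series_monomial[of "k + j" "l + j"]]
    by (simp add: fun_diff_def case_prod_unfold)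
  hence hc: "has_power_series h c"
    unfolding h_def c_def by (intro has_power_series_sum has_power_series_scale)
  \<comment> \<open>Because the \<open>r j\<close> sum to 1, the original monomial cancels and only
    the average of its translates remains.\<close>
  have d_eq: "d x = (\<Sum>j<N. complex_of_real (r j) * coeff_unit (k + j, l + j) x)" for x
  proof -
    have "c x = complex_of_real (\<Sum>j<N. r j) * coeff_unit (k, l) x -
        (\<Sum>j<N. complex_of_real (r j) * coeff_unit (k + j, l + j) x)"
      by (simp add: c_def right_diff_distrib sum_subtractf sum_distrib_right)
    thus ?thesis by (simp add: d_def r_sum)
  qed
  define F where "F = (\<lambda>j. (k + j, l + j)) ` {..<N}"
  have F: "finite F" by (simp add: F_def)
  have d_out: "d x = 0" if "x \<notin> F" for x
    using that unfolding d_eq F_def by (intro sum.neutral) (auto simp: coeff_unit_def)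
  have d_in: "d (k + j, l + j) = r j" if "j < N" for j
    using that by (simp add: d_eq coeff_unit_def sum.delta' if_distrib cong: if_cong)
  have "energy \<alpha> d = (\<Sum>x\<in>F. weight \<alpha> x * (cmod (d x))\<^sup>2)"
    using F d_out by (rule energy_finite_support)
  also have "\<dots> = (\<Sum>j<N. w j * (r j)\<^sup>2)"
    unfolding F_def w_def by (subst sum.reindex) (auto simp: inj_on_def d_in)
  \<comment> \<open>By the choice of \<open>r\<close>, the product \<open>w j * r j\<close> equals
    \<open>1 / T\<close> for every \<open>j\<close>.\<close>
  also have "\<dots> = (\<Sum>j<N. r j / T)"
    using w[THEN less_imp_neq] by (intro sum.cong) (auto simp: r_def power2_eq_square field_simps)
  also have "\<dots> = inverse T"
    by (simp add: r_sum inverse_eq_divide flip: sum_divide_distrib)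
  finally have small: "energy \<alpha> d < \<epsilon>" using T by simp
  have fin: "finite_energy \<alpha> d"
    using F d_out by (rule finite_energy_finite_support)
  show "\<exists>h\<in>generated_span. \<exists>c. has_power_series h c \<and>
      finite_energy \<alpha> (\<lambda>x. coeff_unit (k, l) x - c x) \<and> energy \<alpha> (\<lambda>x. coeff_unit (k, l) x - c x) < \<epsilon>"
    using hc fin small unfolding d_def by (intro bexI[OF _ h] exI[of _ c] conjI)
qed

text \<open>A finite truncation is a combination of monomials, each of them approximable, and the
  remaining tail has small energy.\<close>

lemma approximable_finite_energy:
  assumes "\<alpha> \<le> 1 / 2" and a: "finite_energy \<alpha> a"
  shows "approximable \<alpha> a"
  unfolding approximable_def
proof (intro allI impI)
  fix \<epsilon> :: real assume e: "\<epsilon> > 0"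
  obtain F where F: "finite F" "energy \<alpha> (\<lambda>x. if x \<in> F then 0 else a x) < \<epsilon> / 4"
    using energy_truncation[OF a, of "\<epsilon> / 4"] e by auto
  let ?t = "\<lambda>x. if x \<in> F then 0 else a x"
  let ?p = "\<lambda>x. \<Sum>y\<in>F. a y * coeff_unit y x"
  have p: "?p x = (if x \<in> F then a x else 0)" for x
    using F(1) by (simp add: coeff_unit_def if_distrib cong: if_cong)
  have "approximable \<alpha> ?p"
    using approximable_unit[OF assms(1)] by (intro approximable_sum approximable_scale) auto
  then obtain h c where h: "h \<in> generated_span" "has_power_series h c"
    "finite_energy \<alpha> (\<lambda>x. ?p x - c x)" "energy \<alpha> (\<lambda>x. ?p x - c x) < \<epsilon> / 4"
    using e by (elim approximableE[where \<epsilon> = "\<epsilon> / 4"]) auto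
  have t_eq: "?t = (\<lambda>x. a x - ?p x)" by (auto simp: p)
  have t: "finite_energy \<alpha> ?t"
    unfolding t_eq
    by (intro finite_energy_diff a finite_energy_finite_support[OF F(1)]) (simp add: p)
  \<comment> \<open>The error splits into the tail and the error on the polynomial part, each of
    energy below \<open>\<epsilon> / 4\<close>.\<close>
  have *: "(\<lambda>x. a x - c x) = (\<lambda>x. ?t x + (?p x - c x))" by (auto simp: p)
  show "\<exists>h\<in>generated_span. \<exists>c. has_power_series h c \<and> finite_energy \<alpha> (\<lambda>x. a x - c x) \<and>
      energy \<alpha> (\<lambda>x. a x - c x) < \<epsilon>"
  proof (intro bexI[OF _ h(1)] exI[of _ c] conjI h(2))
    show "finite_energy \<alpha> (\<lambda>x. a x - c x)"
      unfolding * by (rule finite_energy_add[OF t h(3)])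
    show "energy \<alpha> (\<lambda>x. a x - c x) < \<epsilon>"
      using energy_add_le[OF t h(3)] h(4) F(2) e unfolding *[symmetric] by linarith
  qed
qed

section \<open>Both implications of the characterization\<close>

theorem mainTheorem3:
  fixes \<alpha> :: real
  shows "cyclic \<alpha> (\<lambda>(z1, z2). 1 - z1 * z2) \<longleftrightarrow> \<alpha> \<le> 1 / 2"
proof
  \<comment> \<open>The constant 1 is written as a monomial so that
    \<open>has_power_series_monomial\<close> applies to it directly.\<close>
  let ?one = "\<lambda>(z1, z2). z1 ^ 0 * z2 ^ 0 :: complex"
  assume cyc: "cyclic \<alpha> (\<lambda>(z1, z2). 1 - z1 * z2)"
  show "\<alpha> \<le> 1 / 2"
  proof (rule ccontr)
    assume "\<not> \<alpha> \<le> 1 / 2"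
    hence \<alpha>: "\<alpha> > 1 / 2" by simp
    define C where "C = (\<Sum>n. (real n + 1) powr (- 2 * \<alpha>))"
    have one: "?one \<in> dirichlet_space \<alpha>"
      using has_power_series_monomial finite_energy_unit unfolding dirichlet_space_iff by blast
    hence "?one \<in> dirichlet_closure \<alpha> generated_span"
      using cyc unfolding cyclic_def generated_span_def by simp
    \<comment> \<open>Replacing \<open>C\<close> by \<open>\<bar>C\<bar> + 1\<close> gives an upper
      bound that is visibly positive; at this distance the diagonal bound is violated.\<close>
    moreover have "1 / sqrt (\<bar>C\<bar> + 1) > 0" by simp
    ultimately obtain h where h: "h \<in> generated_span" "h \<in> dirichlet_space \<alpha>"
      and close: "dirichlet_norm \<alpha> (?one - h) < 1 / sqrt (\<bar>C\<bar> + 1)"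
      unfolding dirichlet_closure_def by blast
    obtain a where a: "has_power_series h a" "((\<lambda>n. a (n, n)) has_sum 0) UNIV"
      using generated_span_diagonal_sum[OF h(1)] by blast
    \<comment> \<open>Membership of \<open>h\<close> yields some array of finite energy, and
      uniqueness of coefficients identifies it with \<open>a\<close>.\<close>
    have fin_a: "finite_energy \<alpha> a"
      using h(2) power_coeff_eq a(1) unfolding dirichlet_space_iff by metis
    let ?b = "\<lambda>x. coeff_unit (0, 0) x - a x"
    have "((\<lambda>n. coeff_unit (0, 0) (n, n)) has_sum 1) UNIV"
      by (rule has_sum_finite_neutralI[where B = "{0}"]) (auto simp: coeff_unit_def)
    from has_sum_add[OF this has_sum_cmult_right[OF a(2), of "-1"]] have "((\<lambda>n. ?b (n, n)) has_sum 1) UNIV" by simp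
    from diagonal_sum_bound[OF \<alpha> finite_energy_diff[OF finite_energy_unit fin_a] this]
    have "1 \<le> C * energy \<alpha> ?b" by (simp add: C_def)
    also have "\<dots> \<le> (\<bar>C\<bar> + 1) * energy \<alpha> ?b"
      by (intro mult_right_mono energy_nonneg) auto
    finally have ge: "1 \<le> (\<bar>C\<bar> + 1) * energy \<alpha> ?b" .
    have "sqrt (energy \<alpha> ?b) < 1 / sqrt (\<bar>C\<bar> + 1)"
      using close unfolding dirichlet_norm_eq[OF has_power_series_diff[OF has_power_series_monomial a(1)]] .
    hence "sqrt ((\<bar>C\<bar> + 1) * energy \<alpha> ?b) < 1"
      unfolding real_sqrt_mult by (subst (asm) pos_less_divide_eq) (auto simp: mult.commute)
    hence "(\<bar>C\<bar> + 1) * energy \<alpha> ?b < 1" unfolding real_sqrt_lt_1_iff .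
    with ge show False by linarith
  qed
next
  assume \<alpha>: "\<alpha> \<le> 1 / 2"
  let ?f = "\<lambda>(z1, z2). 1 - z1 * z2 :: complex"
  have "has_power_series ?f (\<lambda>x. coeff_unit (0, 0) x - coeff_unit (1, 1) x)"
    using has_power_series_diff[OF has_power_series_monomial[of 0 0] has_power_series_monomial[of 1 1]]
    by (simp add: fun_diff_def case_prod_unfold)
  hence f: "?f \<in> dirichlet_space \<alpha>"
    using finite_energy_diff[OF finite_energy_unit finite_energy_unit] unfolding dirichlet_space_iff by blast
  have "g \<in> dirichlet_closure \<alpha> generated_span" if g: "g \<in> dirichlet_space \<alpha>" for g
    unfolding dirichlet_closure_def
  proof (intro CollectI conjI g allI impI)
    fix \<epsilon> :: real assume e: "\<epsilon> > 0"
    obtain a where a: "has_power_series g a" "finite_energy \<alpha> a"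
      using g unfolding dirichlet_space_iff by blast
    \<comment> \<open>The tolerance is squared because \<open>energy\<close> is the square of the
      norm.\<close>
    from approximable_finite_energy[OF \<alpha> a(2)] e obtain h c where h: "h \<in> generated_span"
      "has_power_series h c" "finite_energy \<alpha> (\<lambda>x. a x - c x)" "energy \<alpha> (\<lambda>x. a x - c x) < \<epsilon>\<^sup>2"
      by (elim approximableE[where \<epsilon> = "\<epsilon>\<^sup>2"]) auto
    \<comment> \<open>Here \<open>c\<close> is recovered as \<open>a - (a - c)\<close>, which places
      \<open>h\<close> in the space as the closure demands.\<close>
    have "finite_energy \<alpha> c" using finite_energy_diff[OF a(2) h(3)] by simp
    hence "h \<in> dirichlet_space \<alpha>" using h(2) unfolding dirichlet_space_iff by blast
    moreover have "dirichlet_norm \<alpha> (g - h) < \<epsilon>"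
      using h(4) e dirichlet_norm_eq[OF has_power_series_diff[OF a(1) h(2)]]
      by (simp add: real_less_lsqrt real_sqrt_less_iff[of _ "\<epsilon>\<^sup>2", symmetric])
    ultimately show "\<exists>h\<in>generated_span \<inter> dirichlet_space \<alpha>. dirichlet_norm \<alpha> (g - h) < \<epsilon>"
      using h(1) by blast
  qed
  \<comment> \<open>The reverse inclusion is built into \<open>dirichlet_closure\<close>, which only
    collects elements of the space.\<close>
  hence "dirichlet_closure \<alpha> generated_span = dirichlet_space \<alpha>"
    unfolding dirichlet_closure_def by blast
  with f show "cyclic \<alpha> ?f" unfolding cyclic_def generated_span_def by simp
qed

end
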